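(* Assume that $0<r_k\le \frac{3+\sqrt{17}}{2}$ for all step ratios $r_k$, and that $\kappa\le 0$ in $\Omega$. Let $u^1,\dots,u^N\in H^1_0(\Omega)$ be the solution of the adaptive BDF2 scheme with initial value $u^0=u_0\in H_0^1(\Omega)$. Then the discrete energies $E^0,\dots,E^N$ satisfy $$\frac{E^k-E^{k-1}}{\tau_k}\le 2\left\langle f^k,\frac{u^k-u^{k-1}}{\tau_k}\right\rangle\qquad\text{for }1\le k\le N,$$ and consequently $$\sqrt{E^n}\le \sqrt{E^0}+4\varepsilon^{-1/2}C_{\Omega}\Big(\|f^1\|+\sum_{k=2}^{n}\|f^{k}-f^{k-1}\|\Big)\qquad\text{for }1\le n\le N.$$
   Context: Let $\Omega$ be a bounded convex domain with smooth boundary, $\varepsilon>0$ a constant, $\kappa=\kappa(x)$ a smooth bounded function on $\Omega$, $T>0$. $\langle\cdot,\cdot\rangle$ and $\|\cdot\|$ are the $L^2(\Omega)$ inner product and norm, $|w|_1=\|\nabla w\|$ is the $H^1$ seminorm, and $C_\Omega>0$ is a constant such that $\|w\|\le C_\Omega|w|_1$ for all $w\in H_0^1(\Omega)$. Time mesh: $0=t_0<t_1<\cdots<t_N=T$, $\tau_k=t_k-t_{k-1}$ for $1\le k\le N$, $r_k=\tau_k/\tau_{k-1}$ for $2\le k\le N$. In addition $r_{N+1}$ (which appears in $E^N$) denotes any fixed number in $(0,\frac{3+\sqrt{17}}{2}]$. BDF2 operator (with a BDF1 first step): for a sequence $(v^n)_{n=0}^N$, $$D_2v^1=\frac{v^1-v^0}{\tau_1},\qquad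 D_2v^n=\frac{1+2r_{n}}{\tau_n(1+r_{n})}(v^{n}-v^{n-1})-\frac{r_{n}^2}{\tau_n(1+r_{n})}(v^{n-1}-v^{n-2})\quad(2\le n\le N).$$ Adaptive BDF2 scheme: given $f^n\in L^2(\Omega)$ for $1\le n\le N$, the functions $u^n\in H_0^1(\Omega)$, $1\le n\le N$, satisfy $$\langle D_2u^{n},w\rangle+\varepsilon\langle\nabla u^{n},\nabla w\rangle=\langle\kappa u^{n},w\rangle+\langle f^n,w\rangle\qquad\text{for all }w\in H_0^1(\Omega)$$ (the time discretization of $\partial_tu-\varepsilon\Delta u=\kappa u+f$ with homogeneous Dirichlet boundary condition). Discrete energy: $$E^0=\varepsilon|u^0|_1^2+\langle-\kappa u^0,u^0\rangle,\qquad E^k=\frac{r_{k+1}}{1+r_{k+1}}\,\tau_k\Big\|\frac{u^k-u^{k-1}}{\tau_k}\Big\|^2+\varepsilon|u^k|_1^2+\langle-\kappa u^k,u^k\rangle\quad(1\le k\le N).$$ *)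

theory Defs
  imports "HOL-Analysis.Analysis"
begin

text \<open>
  \<open>Ck_on k S f\<close> is intended for open \<open>S\<close> only, where derivatives within \<open>S\<close> and derivatives at a
  point coincide.
\<close>

fun Ck_on :: "nat \<Rightarrow> 'a::euclidean_space set \<Rightarrow> ('a \<Rightarrow> real) \<Rightarrow> bool" where
  "Ck_on 0 S f \<longleftrightarrow> continuous_on S f"
| "Ck_on (Suc k) S f \<longleftrightarrow>
     (\<forall>x\<in>S. f differentiable (at x)) \<and>
     (\<forall>v. Ck_on k S (\<lambda>x. frechet_derivative f (at x) v))"

definition smooth_on :: "'a::euclidean_space set \<Rightarrow> ('a \<Rightarrow> real) \<Rightarrow> bool" where
  "smooth_on S f \<longleftrightarrow> (\<forall>k. Ck_on k S f)"

text \<open>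
  Near each boundary point, the set is the sublevel set of a smooth function without critical
  points, so it lies locally on one side of its boundary hypersurface.
\<close>

definition smooth_boundary :: "'a::euclidean_space set \<Rightarrow> bool" where
  "smooth_boundary \<Omega> \<longleftrightarrow>
     (\<forall>p\<in>frontier \<Omega>. \<exists>U \<rho>. open U \<and> p \<in> U \<and> smooth_on U \<rho> \<and>
        (\<forall>x\<in>U. \<exists>v. frechet_derivative \<rho> (at x) v \<noteq> 0) \<and>
        \<Omega> \<inter> U = {x \<in> U. \<rho> x < 0})"

text \<open>
  Elements of these spaces are represented by functions rather than by classes modulo equality
  almost everywhere; only the values on \<open>\<Omega>\<close> matter. The value type \<open>'b\<close> is \<open>real\<close> for scalar
  functions and the ambient space for gradients.
\<close>

definition L2 :: "'a::euclidean_space set \<Rightarrow> ('a \<Rightarrow> 'b::euclidean_space) set" where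
  "L2 \<Omega> = {f \<in> borel_measurable (lebesgue_on \<Omega>).
             integrable (lebesgue_on \<Omega>) (\<lambda>x. (norm (f x))\<^sup>2)}"

definition L2_inner ::
  "'a::euclidean_space set \<Rightarrow> ('a \<Rightarrow> 'b::euclidean_space) \<Rightarrow> ('a \<Rightarrow> 'b) \<Rightarrow> real" where
  "L2_inner \<Omega> f g = (LINT x|lebesgue_on \<Omega>. f x \<bullet> g x)"

definition L2_norm :: "'a::euclidean_space set \<Rightarrow> ('a \<Rightarrow> 'b::euclidean_space) \<Rightarrow> real" where
  "L2_norm \<Omega> f = sqrt (L2_inner \<Omega> f f)"

definition test_functions :: "'a::euclidean_space set \<Rightarrow> ('a \<Rightarrow> real) set" where
  "test_functions \<Omega> =
     {\<phi>. smooth_on UNIV \<phi> \<and> compact (closure {x. \<phi> x \<noteq> 0}) \<and> closure {x. \<phi> x \<noteq> 0} \<subseteq> \<Omega>}"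

definition is_weak_gradient ::
  "'a::euclidean_space set \<Rightarrow> ('a \<Rightarrow> real) \<Rightarrow> ('a \<Rightarrow> 'a) \<Rightarrow> bool" where
  "is_weak_gradient \<Omega> u g \<longleftrightarrow>
     (\<forall>\<phi>\<in>test_functions \<Omega>. \<forall>i\<in>Basis.
        (LINT x|lebesgue_on \<Omega>. u x * frechet_derivative \<phi> (at x) i) =
        - (LINT x|lebesgue_on \<Omega>. (g x \<bullet> i) * \<phi> x))"

definition H1 :: "'a::euclidean_space set \<Rightarrow> ('a \<Rightarrow> real) set" where
  "H1 \<Omega> = {u \<in> L2 \<Omega>. \<exists>g\<in>L2 \<Omega>. is_weak_gradient \<Omega> u g}"

text \<open>The weak gradient is determined up to null sets; an arbitrary representative is chosen.\<close>

definition weak_grad :: "'a::euclidean_space set \<Rightarrow> ('a \<Rightarrow> real) \<Rightarrow> 'a \<Rightarrow> 'a" where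
  "weak_grad \<Omega> u = (SOME g. g \<in> L2 \<Omega> \<and> is_weak_gradient \<Omega> u g)"

definition H1_seminorm :: "'a::euclidean_space set \<Rightarrow> ('a \<Rightarrow> real) \<Rightarrow> real" where
  "H1_seminorm \<Omega> u = L2_norm \<Omega> (weak_grad \<Omega> u)"

definition H1_norm :: "'a::euclidean_space set \<Rightarrow> ('a \<Rightarrow> real) \<Rightarrow> real" where
  "H1_norm \<Omega> u = sqrt ((L2_norm \<Omega> u)\<^sup>2 + (H1_seminorm \<Omega> u)\<^sup>2)"

definition H10 :: "'a::euclidean_space set \<Rightarrow> ('a \<Rightarrow> real) set" where
  "H10 \<Omega> = {u \<in> H1 \<Omega>. \<exists>\<phi>. (\<forall>n. \<phi> n \<in> test_functions \<Omega>) \<and>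
               (\<lambda>n::nat. H1_norm \<Omega> (\<lambda>x. \<phi> n x - u x)) \<longlonglongrightarrow> 0}"

definition time_step :: "(nat \<Rightarrow> real) \<Rightarrow> nat \<Rightarrow> real" where
  "time_step t k = t k - t (k - 1)"

definition diff_quot :: "(nat \<Rightarrow> real) \<Rightarrow> (nat \<Rightarrow> 'a \<Rightarrow> real) \<Rightarrow> nat \<Rightarrow> 'a \<Rightarrow> real" where
  "diff_quot t v k x = (v k x - v (k - 1) x) / time_step t k"

text \<open>
  The mesh nodes are \<open>t\<close> and the step ratios are \<open>r\<close>. The ratios are a separate argument because
  the energy at the final time level involves a number \<open>r (N + 1)\<close> not determined by the mesh.
  The operator is only meaningful for \<open>n \<ge> 1\<close>; the first step is BDF1.
\<close>

definition D2 ::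
  "(nat \<Rightarrow> real) \<Rightarrow> (nat \<Rightarrow> real) \<Rightarrow> (nat \<Rightarrow> 'a \<Rightarrow> real) \<Rightarrow> nat \<Rightarrow> 'a \<Rightarrow> real" where
  "D2 t r v n x =
     (if n = 1 then (v 1 x - v 0 x) / time_step t 1
      else (1 + 2 * r n) / (time_step t n * (1 + r n)) * (v n x - v (n - 1) x)
         - (r n)\<^sup>2 / (time_step t n * (1 + r n)) * (v (n - 1) x - v (n - 2) x))"

definition bdf2_solution ::
  "'a::euclidean_space set \<Rightarrow> real \<Rightarrow> ('a \<Rightarrow> real) \<Rightarrow> (nat \<Rightarrow> real) \<Rightarrow> (nat \<Rightarrow> real) \<Rightarrow> nat \<Rightarrow>
   (nat \<Rightarrow> 'a \<Rightarrow> real) \<Rightarrow> (nat \<Rightarrow> 'a \<Rightarrow> real) \<Rightarrow> bool" where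
  "bdf2_solution \<Omega> \<epsilon> \<kappa> t r N f u \<longleftrightarrow>
     (\<forall>n\<in>{1..N}. u n \<in> H10 \<Omega> \<and>
        (\<forall>w\<in>H10 \<Omega>.
           L2_inner \<Omega> (D2 t r u n) w + \<epsilon> * L2_inner \<Omega> (weak_grad \<Omega> (u n)) (weak_grad \<Omega> w) =
           L2_inner \<Omega> (\<lambda>x. \<kappa> x * u n x) w + L2_inner \<Omega> (f n) w))"

definition discrete_energy ::
  "'a::euclidean_space set \<Rightarrow> real \<Rightarrow> ('a \<Rightarrow> real) \<Rightarrow> (nat \<Rightarrow> real) \<Rightarrow> (nat \<Rightarrow> real) \<Rightarrow>
   (nat \<Rightarrow> 'a \<Rightarrow> real) \<Rightarrow> nat \<Rightarrow> real" where
  "discrete_energy \<Omega> \<epsilon> \<kappa> t r u k =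
     (if k = 0 then 0
      else r (k + 1) / (1 + r (k + 1)) * time_step t k * (L2_norm \<Omega> (diff_quot t u k))\<^sup>2)
     + \<epsilon> * (H1_seminorm \<Omega> (u k))\<^sup>2 + L2_inner \<Omega> (\<lambda>x. - \<kappa> x * u k x) (u k)"

end

theory Submission
  imports Defs
begin

text \<open>
  Testing the scheme with \<open>w = u\<^sup>n\<close> and with \<open>w = u\<^sup>n\<^sup>-\<^sup>1\<close> separately and subtracting
  gives the identity for \<open>w = u\<^sup>n - u\<^sup>n\<^sup>-\<^sup>1\<close> without using linearity of the chosen weak gradients.
  The gradient and reaction terms are nonnegative quadratic forms \<open>q\<close>, for which
  \<open>2 q(a, a - b) \<ge> q(a, a) - q(b, b)\<close>. The BDF2 term dominates the increment of the modified kinetic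
  energy because \<open>s / (1 + s) \<le> (2 + 4 r - r\<^sup>2) / (1 + r)\<close> for \<open>0 < r, s \<le> (3 + sqrt 17) / 2\<close>, the
  upper bound being the positive root of \<open>r\<^sup>2 = 3 r + 2\<close>. For the second estimate, the energy law
  is summed by parts, so that differences fall on \<open>f\<close>, and applied at the time level at which
  the energy is largest.
\<close>

section \<open>Square-integrable functions: linearity, Cauchy-Schwarz, weighted forms\<close>

lemma L2_measurable: "f \<in> L2 \<Omega> \<Longrightarrow> f \<in> borel_measurable (lebesgue_on \<Omega>)"
  by (simp add: L2_def)

lemma L2_integrable_inner:
  assumes "f \<in> L2 \<Omega>" "g \<in> L2 \<Omega>"
  shows "integrable (lebesgue_on \<Omega>) (\<lambda>x. f x \<bullet> g x)"
proof (rule Bochner_Integration.integrable_bound)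
  show "integrable (lebesgue_on \<Omega>) (\<lambda>x. (norm (f x))\<^sup>2 + (norm (g x))\<^sup>2)"
    using assms by (auto simp: L2_def)
  show "(\<lambda>x. f x \<bullet> g x) \<in> borel_measurable (lebesgue_on \<Omega>)"
    by (intro borel_measurable_inner L2_measurable assms)
  have "\<bar>a \<bullet> b\<bar> \<le> (norm a)\<^sup>2 + (norm b)\<^sup>2" for a b :: 'b
    using Cauchy_Schwarz_ineq2[of a b] sum_squares_bound[of "norm a" "norm b"]
      mult_nonneg_nonneg[of "norm a" "norm b"] by simp
  then show "AE x in lebesgue_on \<Omega>. norm (f x \<bullet> g x) \<le> norm ((norm (f x))\<^sup>2 + (norm (g x))\<^sup>2)"
    by simp
qed

lemma L2_add:
  assumes "f \<in> L2 \<Omega>" "g \<in> L2 \<Omega>"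
  shows "(\<lambda>x. f x + g x) \<in> L2 \<Omega>"
proof -
  have "integrable (lebesgue_on \<Omega>) (\<lambda>x. f x \<bullet> f x + 2 * (f x \<bullet> g x) + g x \<bullet> g x)"
    using assms by (intro Bochner_Integration.integrable_add integrable_mult_right L2_integrable_inner)
  moreover have "(\<lambda>x. f x \<bullet> f x + 2 * (f x \<bullet> g x) + g x \<bullet> g x) = (\<lambda>x. (norm (f x + g x))\<^sup>2)"
    by (auto simp: power2_norm_eq_inner inner_add_left inner_add_right inner_commute)
  ultimately show ?thesis
    using assms by (auto simp: L2_def)
qed

text \<open>Serves both for constant \<open>c\<close>, giving closure under scalar multiples, and
  for \<open>c = \<kappa>\<close> in the reaction term.\<close>

lemma L2_bounded_scaleR:
  assumes "c \<in> borel_measurable (lebesgue_on \<Omega>)" "bounded (c ` \<Omega>)" "f \<in> L2 \<Omega>"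
  shows "(\<lambda>x. c x *\<^sub>R f x) \<in> L2 \<Omega>"
proof -
  obtain B where B: "\<And>x. x \<in> \<Omega> \<Longrightarrow> \<bar>c x\<bar> \<le> B"
    using assms(2) by (auto simp: bounded_iff)
  have "integrable (lebesgue_on \<Omega>) (\<lambda>x. (norm (c x *\<^sub>R f x))\<^sup>2)"
  proof (rule Bochner_Integration.integrable_bound)
    show "integrable (lebesgue_on \<Omega>) (\<lambda>x. B\<^sup>2 * (norm (f x))\<^sup>2)"
      using assms by (auto simp: L2_def)
    show "(\<lambda>x. (norm (c x *\<^sub>R f x))\<^sup>2) \<in> borel_measurable (lebesgue_on \<Omega>)"
      using assms(1) L2_measurable[OF assms(3)] by measurable
    have "(c x)\<^sup>2 \<le> B\<^sup>2" if "x \<in> \<Omega>" for x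
      using power_mono[OF B[OF that], of 2] by simp
    then show "AE x in lebesgue_on \<Omega>.
        norm ((norm (c x *\<^sub>R f x))\<^sup>2) \<le> norm (B\<^sup>2 * (norm (f x))\<^sup>2)"
      by (intro AE_I2) (simp add: power_mult_distrib mult_right_mono)
  qed
  then show ?thesis
    using assms(1) L2_measurable[OF assms(3)] by (auto simp: L2_def)
qed

lemma L2_scaleR: "f \<in> L2 \<Omega> \<Longrightarrow> (\<lambda>x. c *\<^sub>R f x) \<in> L2 \<Omega>"
  by (rule L2_bounded_scaleR) (auto intro: finite_imp_bounded finite_subset[of _ "{c}"])

lemma L2_diff:
  assumes "f \<in> L2 \<Omega>" "g \<in> L2 \<Omega>"
  shows "(\<lambda>x. f x - g x) \<in> L2 \<Omega>"
  using L2_add[OF assms(1) L2_scaleR[OF assms(2), of "-1"]] by simp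

lemma L2_inner_commute: "L2_inner \<Omega> f g = L2_inner \<Omega> g f"
  by (simp add: L2_inner_def inner_commute)

lemma L2_inner_diff_left:
  assumes "f \<in> L2 \<Omega>" "g \<in> L2 \<Omega>" "h \<in> L2 \<Omega>"
  shows "L2_inner \<Omega> (\<lambda>x. f x - g x) h = L2_inner \<Omega> f h - L2_inner \<Omega> g h"
  using assms by (simp add: L2_inner_def inner_diff_left L2_integrable_inner)

lemma L2_inner_diff_right:
  assumes "f \<in> L2 \<Omega>" "g \<in> L2 \<Omega>" "h \<in> L2 \<Omega>"
  shows "L2_inner \<Omega> h (\<lambda>x. f x - g x) = L2_inner \<Omega> h f - L2_inner \<Omega> h g"
  using L2_inner_diff_left[OF assms] by (simp add: L2_inner_commute)

lemma L2_inner_scaleR_left: "L2_inner \<Omega> (\<lambda>x. c *\<^sub>R f x) g = c * L2_inner \<Omega> f g"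
  by (simp add: L2_inner_def)

lemma L2_inner_scaleR_right: "L2_inner \<Omega> f (\<lambda>x. c *\<^sub>R g x) = c * L2_inner \<Omega> f g"
  by (simp add: L2_inner_def)

lemma L2_inner_nonneg: "0 \<le> L2_inner \<Omega> f f"
  by (simp add: L2_inner_def)

lemma L2_norm_nonneg: "0 \<le> L2_norm \<Omega> f"
  by (simp add: L2_norm_def L2_inner_nonneg)

lemma L2_norm_power2: "(L2_norm \<Omega> f)\<^sup>2 = L2_inner \<Omega> f f"
  by (simp add: L2_norm_def L2_inner_nonneg)

text \<open>Expand the square of the norm of \<open>c *\<^sub>R f x - g x\<close>. The parameter
  \<open>c\<close> stays free: it becomes the step ratio in the kinetic bound, 1 for the gradient
  form, and the optimal multiplier for Cauchy-Schwarz.\<close>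

lemma L2_inner_young:
  assumes "f \<in> L2 \<Omega>" "g \<in> L2 \<Omega>"
  shows "2 * c * L2_inner \<Omega> f g \<le> c\<^sup>2 * L2_inner \<Omega> f f + L2_inner \<Omega> g g"
proof -
  have "0 \<le> L2_inner \<Omega> (\<lambda>x. c *\<^sub>R f x - g x) (\<lambda>x. c *\<^sub>R f x - g x)"
    by (rule L2_inner_nonneg)
  also have "\<dots> = c\<^sup>2 * L2_inner \<Omega> f f - 2 * c * L2_inner \<Omega> f g + L2_inner \<Omega> g g"
    using assms L2_inner_commute[of \<Omega> g f]
    by (simp add: L2_inner_diff_left L2_inner_diff_right L2_diff L2_scaleR L2_inner_scaleR_left
        L2_inner_scaleR_right power2_eq_square algebra_simps)
  finally show ?thesis by simp
qed

lemma L2_Cauchy_Schwarz: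
  assumes "f \<in> L2 \<Omega>" "g \<in> L2 \<Omega>"
  shows "\<bar>L2_inner \<Omega> f g\<bar> \<le> L2_norm \<Omega> f * L2_norm \<Omega> g"
proof -
  define a b c where "a = L2_inner \<Omega> f f" "b = L2_inner \<Omega> f g" "c = L2_inner \<Omega> g g"
  have young: "2 * x * b \<le> x\<^sup>2 * a + c" for x
    using L2_inner_young[OF assms] by (simp add: a_b_c_def)
  have "0 \<le> a" "0 \<le> c"
    by (simp_all add: a_b_c_def L2_inner_nonneg)
  have "b\<^sup>2 \<le> a * c"
  proof (cases "a = 0")
    case True
    have "b = 0"
    proof (rule ccontr)
      assume "b \<noteq> 0"
      \<comment> \<open>With \<open>a = 0\<close>, this value of the parameter makes the inequality
        read \<open>2 * (c + 1) \<le> c\<close>.\<close>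
      then show False
        using young[of "(c + 1) / b"] True \<open>0 \<le> c\<close> by simp
    qed
    then show ?thesis using True by simp
  next
    case False
    with \<open>0 \<le> a\<close> have "0 < a" by simp
    \<comment> \<open>The value \<open>b / a\<close> minimizes the quadratic
      \<open>x\<^sup>2 * a - 2 * x * b + c\<close>.\<close>
    then show ?thesis
      using young[of "b / a"] by (simp add: field_simps power2_eq_square)
  qed
  then have "sqrt (b\<^sup>2) \<le> sqrt (a * c)"
    by (rule real_sqrt_le_mono)
  then show ?thesis
    by (simp add: L2_norm_def a_b_c_def real_sqrt_mult)
qed

text \<open>Split the first factor of the inner product of \<open>f\<close> with itself as
  \<open>g\<close> plus the difference, apply Cauchy-Schwarz and cancel one norm of
  \<open>f\<close>. This form of the triangle inequality telescopes over the source terms.\<close>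

lemma L2_norm_le_add_diff:
  assumes "f \<in> L2 \<Omega>" "g \<in> L2 \<Omega>"
  shows "L2_norm \<Omega> f \<le> L2_norm \<Omega> g + L2_norm \<Omega> (\<lambda>x. f x - g x)"
proof -
  let ?d = "\<lambda>x. f x - g x"
  have d: "?d \<in> L2 \<Omega>"
    using assms by (rule L2_diff)
  have "(L2_norm \<Omega> f)\<^sup>2 = L2_inner \<Omega> g f + L2_inner \<Omega> ?d f"
    using assms by (simp add: L2_norm_power2 L2_inner_diff_left)
  also have "\<dots> \<le> L2_norm \<Omega> g * L2_norm \<Omega> f + L2_norm \<Omega> ?d * L2_norm \<Omega> f"
    using L2_Cauchy_Schwarz[OF assms(2,1)] L2_Cauchy_Schwarz[OF d assms(1)] by linarith
  finally have "L2_norm \<Omega> f * L2_norm \<Omega> f \<le> (L2_norm \<Omega> g + L2_norm \<Omega> ?d) * L2_norm \<Omega> f"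
    by (simp add: power2_eq_square algebra_simps)
  then show ?thesis
    using L2_norm_nonneg[of \<Omega> f] L2_norm_nonneg[of \<Omega> g] L2_norm_nonneg[of \<Omega> ?d]
    by (cases "L2_norm \<Omega> f = 0") auto
qed

text \<open>The symmetric form with weight \<open>c\<close> is nonpositive at \<open>u - v\<close>;
  expanding it there gives the claim.\<close>

lemma L2_weighted_convexity:
  fixes u v :: "'a::euclidean_space \<Rightarrow> real"
  assumes c: "c \<in> borel_measurable (lebesgue_on \<Omega>)" "bounded (c ` \<Omega>)" "\<forall>x\<in>\<Omega>. c x \<le> 0"
    and uv: "u \<in> L2 \<Omega>" "v \<in> L2 \<Omega>"
  shows "2 * (L2_inner \<Omega> (\<lambda>x. c x * u x) u - L2_inner \<Omega> (\<lambda>x. c x * u x) v)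
         \<le> L2_inner \<Omega> (\<lambda>x. c x * u x) u - L2_inner \<Omega> (\<lambda>x. c x * v x) v"
proof -
  have cL2: "(\<lambda>x. c x * w x) \<in> L2 \<Omega>" if "w \<in> L2 \<Omega>" for w
    using L2_bounded_scaleR[OF c(1,2) that] by simp
  have "L2_inner \<Omega> (\<lambda>x. c x * (u x - v x)) (\<lambda>x. u x - v x) \<le> 0"
  proof -
    have "0 \<le> (LINT x|lebesgue_on \<Omega>. - ((c x * (u x - v x)) \<bullet> (u x - v x)))"
      using c(3) by (intro integral_nonneg_AE AE_I2)
        (auto simp: mult_nonpos_nonneg mult.assoc)
    then show ?thesis by (simp add: L2_inner_def)
  qed
  moreover have "L2_inner \<Omega> (\<lambda>x. c x * v x) u = L2_inner \<Omega> (\<lambda>x. c x * u x) v"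
    by (simp add: L2_inner_def mult.commute mult.left_commute)
  ultimately show ?thesis
    using uv by (simp add: right_diff_distrib L2_inner_diff_left L2_inner_diff_right L2_diff cL2)
qed

text \<open>Membership in \<open>H1 \<Omega>\<close> supplies a square-integrable weak gradient, so
  the choice in \<open>weak_grad\<close> has a witness.\<close>

lemma H10_L2:
  assumes "u \<in> H10 \<Omega>"
  shows "u \<in> L2 \<Omega>" "weak_grad \<Omega> u \<in> L2 \<Omega>"
proof -
  from assms have "u \<in> L2 \<Omega>" "\<exists>g. g \<in> L2 \<Omega> \<and> is_weak_gradient \<Omega> u g"
    by (auto simp: H10_def H1_def)
  then show "u \<in> L2 \<Omega>" "weak_grad \<Omega> u \<in> L2 \<Omega>"
    unfolding weak_grad_def using someI_ex[of "\<lambda>g. g \<in> L2 \<Omega> \<and> is_weak_gradient \<Omega> u g"] by auto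
qed

section \<open>Scalar inequalities: step ratios, kinetic terms, growth of the energy\<close>

text \<open>Let \<open>m\<close> be the largest admissible ratio. The left side increases with
  \<open>s\<close>, so it is at most \<open>m / (1 + m)\<close>, and the right side is at least this
  value for \<open>0 < r\<close> and \<open>r \<le> m\<close>. At \<open>r = s = m\<close> both
  sides agree.\<close>

lemma ratio_fraction_bound:
  fixes r s :: real
  assumes "0 < r" "r \<le> (3 + sqrt 17) / 2" "0 < s" "s \<le> (3 + sqrt 17) / 2"
  shows "s / (1 + s) \<le> (2 + 4 * r - r\<^sup>2) / (1 + r)"
proof -
  define m where "m = (3 + sqrt 17) / 2"
  have m: "m\<^sup>2 = 3 * m + 2"
    by (simp add: m_def power2_eq_square field_simps)
  have "1 \<le> sqrt 17" by simp
  then have m2: "2 \<le> m" by (simp add: m_def)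
  have le: "r \<le> m" "s \<le> m"
    using assms by (simp_all add: m_def)
  have "s * (1 + r) * (1 + m) \<le> m * (1 + r) * (1 + s)"
  proof -
    have "s * (1 + m) \<le> m * (1 + s)" using le by (simp add: algebra_simps)
    from mult_right_mono[OF this, of "1 + r"] assms show ?thesis by (simp add: algebra_simps)
  qed
  also have "\<dots> \<le> (2 + 4 * r - r\<^sup>2) * (1 + m) * (1 + s)"
  proof (rule mult_right_mono)
    \<comment> \<open>Modulo the equation for \<open>m\<close>, the difference has the root
      \<open>r = m\<close>; the last summand collects the multiple of that equation.\<close>
    have "(2 + 4 * r - r\<^sup>2) * (1 + m) - m * (1 + r) = (m - r) * (r * (1 + m) + (m - 2))
        + (3 * m + 2 - m\<^sup>2) * (1 + r)"
      by (simp add: algebra_simps power2_eq_square)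
    moreover have "0 \<le> (m - r) * (r * (1 + m) + (m - 2))"
      using le m2 assms by (intro mult_nonneg_nonneg add_nonneg_nonneg) auto
    ultimately show "m * (1 + r) \<le> (2 + 4 * r - r\<^sup>2) * (1 + m)"
      using m by simp
  qed (use assms in simp)
  finally have "s * (1 + r) \<le> (2 + 4 * r - r\<^sup>2) * (1 + s)"
    using m2 by (simp add: mult.commute[of _ "1 + m"] mult.left_commute[of _ "1 + m"] mult.assoc)
  then show ?thesis
    using assms by (simp add: field_simps)
qed

text \<open>Here \<open>x\<close> and \<open>y\<close> stand for the squared norms of the current
  and previous difference quotients, \<open>z\<close> for their inner product, \<open>r\<close> and
  \<open>s\<close> for the current and next ratios; the current step length is divided out. Young's
  inequality with weight \<open>r\<close> absorbs the mixed term and leaves \<open>x\<close> with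
  the coefficient from \<open>ratio_fraction_bound\<close>.\<close>

lemma bdf2_kinetic_bound:
  fixes r s x y z :: real
  assumes "0 < r" "r \<le> (3 + sqrt 17) / 2" "0 < s" "s \<le> (3 + sqrt 17) / 2"
    and "0 \<le> x" "2 * r * z \<le> r\<^sup>2 * x + y"
  shows "s / (1 + s) * x - y / (1 + r) \<le> 2 * ((1 + 2 * r) / (1 + r) * x - r / (1 + r) * z)"
proof -
  have "s / (1 + s) * x \<le> (2 + 4 * r - r\<^sup>2) / (1 + r) * x"
    using ratio_fraction_bound[OF assms(1-4)] \<open>0 \<le> x\<close> by (rule mult_right_mono)
  moreover have "2 * r * z / (1 + r) \<le> (r\<^sup>2 * x + y) / (1 + r)"
    using assms by (intro divide_right_mono) auto
  moreover have "(2 + 4 * r - r\<^sup>2) / (1 + r) * x - y / (1 + r)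
      = 2 * ((1 + 2 * r) / (1 + r) * x) - (r\<^sup>2 * x + y) / (1 + r)"
    using assms(1) by (simp add: field_simps)
  ultimately show ?thesis by (simp add: algebra_simps)
qed

text \<open>To be read with \<open>e\<close> as the root of the energy, \<open>\<phi>\<close> as the
  source norms and \<open>\<delta>\<close> as the norms of the source increments. At the index
  \<open>m\<close> where \<open>e\<close> is largest on \<open>{0..n}\<close>, every
  \<open>e\<close> on the right is at most \<open>e m\<close>, so one factor \<open>e m\<close>
  cancels and the quadratic estimate becomes linear.\<close>

lemma sqrt_energy_growth:
  fixes e \<phi> \<delta> :: "nat \<Rightarrow> real" and c :: real
  assumes c: "0 \<le> c" and e: "\<And>k. k \<le> N \<Longrightarrow> 0 \<le> e k" and \<delta>: "\<And>k. 0 \<le> \<delta> k" and \<phi>1: "0 \<le> \<phi> 1"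
    and \<phi>: "\<And>n. n \<in> {1..N} \<Longrightarrow> \<phi> n \<le> \<phi> 1 + (\<Sum>k = 2..n. \<delta> k)"
    and step: "\<And>n. n \<in> {1..N} \<Longrightarrow> (e n)\<^sup>2 \<le> (e 0)\<^sup>2
        + 2 * c * (e n * \<phi> n + e 0 * \<phi> 1 + (\<Sum>k = 2..n. e (k - 1) * \<delta> k))"
    and n: "n \<in> {1..N}"
  shows "e n \<le> e 0 + 4 * c * (\<phi> 1 + (\<Sum>k = 2..n. \<delta> k))"
proof -
  have "Max (e ` {0..n}) \<in> e ` {0..n}"
    by (intro Max_in) auto
  then obtain m where m: "m \<le> n" "Max (e ` {0..n}) = e m"
    by (meson atLeastAtMost_iff imageE)
  have max: "e k \<le> e m" if "k \<le> n" for k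
    using that by (subst m(2)[symmetric]) (auto intro: Max_ge)
  let ?S = "\<lambda>n. \<phi> 1 + (\<Sum>k = 2..n. \<delta> k)"
  have S: "0 \<le> ?S k" for k
    using \<phi>1 \<delta> by (auto intro!: add_nonneg_nonneg sum_nonneg)
  have e0: "0 \<le> e 0" and em: "0 \<le> e m"
    using e n m(1) by auto
  have "e m \<le> e 0 + 4 * c * ?S m"
  proof (cases "m = 0 \<or> e m = 0")
    case True
    then show ?thesis
      using mult_nonneg_nonneg[OF c S[of m]] e0 by auto
  next
    case False
    then have mN: "m \<in> {1..N}" using m n by auto
    have "e 0 * \<phi> 1 \<le> e m * \<phi> 1"
      using max[of 0] \<phi>1 by (simp add: mult_right_mono)
    moreover have "(\<Sum>k = 2..m. e (k - 1) * \<delta> k) \<le> e m * (\<Sum>k = 2..m. \<delta> k)"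
      unfolding sum_distrib_left using m(1) \<delta> by (intro sum_mono mult_right_mono max) auto
    moreover have "e m * \<phi> m \<le> e m * ?S m"
      using \<phi>[OF mN] em by (rule mult_left_mono)
    \<comment> \<open>The term at level \<open>m\<close> contributes one copy of
      \<open>e m * ?S m\<close>, the initial term and the sum together another. With the factor
      \<open>2 * c\<close> this produces the constant 4.\<close>
    ultimately have "e m * \<phi> m + e 0 * \<phi> 1 + (\<Sum>k = 2..m. e (k - 1) * \<delta> k) \<le> 2 * e m * ?S m"
      by (simp add: algebra_simps)
    then have "2 * c * (e m * \<phi> m + e 0 * \<phi> 1 + (\<Sum>k = 2..m. e (k - 1) * \<delta> k))
        \<le> 2 * c * (2 * e m * ?S m)"
      using c by (intro mult_left_mono) auto
    moreover have "(e 0)\<^sup>2 \<le> e m * e 0"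
      using max[of 0] e0 by (simp add: power2_eq_square mult_right_mono)
    ultimately have "e m * e m \<le> e m * (e 0 + 4 * c * ?S m)"
      using step[OF mN] by (simp add: power2_eq_square algebra_simps)
    then show ?thesis
      using False em by simp
  qed
  moreover have "?S m \<le> ?S n"
    using m(1) \<delta> by (intro add_left_mono sum_mono2) auto
  then have "4 * c * ?S m \<le> 4 * c * ?S n"
    using c by (intro mult_left_mono) auto
  ultimately show ?thesis
    using max[of n] by simp
qed

theorem theorem2p1:
  fixes \<Omega> :: "'a::euclidean_space set"
    and \<kappa> u0 :: "'a \<Rightarrow> real"
    and \<epsilon> T C\<^sub>\<Omega> :: real
    and N :: nat
    and t r :: "nat \<Rightarrow> real"
    and f u :: "nat \<Rightarrow> 'a \<Rightarrow> real"
  assumes domain: "open \<Omega>" "\<Omega> \<noteq> {}" "bounded \<Omega>" "convex \<Omega>" "smooth_boundary \<Omega>"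
    and eps_pos: "\<epsilon> > 0"
    and kappa: "smooth_on \<Omega> \<kappa>" "bounded (\<kappa> ` \<Omega>)" "\<forall>x\<in>\<Omega>. \<kappa> x \<le> 0"
    and poincare: "C\<^sub>\<Omega> > 0" "\<forall>w\<in>H10 \<Omega>. L2_norm \<Omega> w \<le> C\<^sub>\<Omega> * H1_seminorm \<Omega> w"
    and mesh: "T > 0" "t 0 = 0" "t N = T" "\<forall>k\<in>{1..N}. t (k - 1) < t k"
    and ratios: "\<forall>k\<in>{2..N}. r k = time_step t k / time_step t (k - 1)"
    and ratio_bound: "\<forall>k\<in>{2..N + 1}. 0 < r k \<and> r k \<le> (3 + sqrt 17) / 2"
    and source: "\<forall>n\<in>{1..N}. f n \<in> L2 \<Omega>"
    and initial: "u0 \<in> H10 \<Omega>" "u 0 = u0"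
    and scheme: "bdf2_solution \<Omega> \<epsilon> \<kappa> t r N f u"
  shows "(\<forall>k\<in>{1..N}.
            (discrete_energy \<Omega> \<epsilon> \<kappa> t r u k - discrete_energy \<Omega> \<epsilon> \<kappa> t r u (k - 1)) / time_step t k
              \<le> 2 * L2_inner \<Omega> (f k) (diff_quot t u k)) \<and>
         (\<forall>n\<in>{1..N}.
            sqrt (discrete_energy \<Omega> \<epsilon> \<kappa> t r u n)
              \<le> sqrt (discrete_energy \<Omega> \<epsilon> \<kappa> t r u 0)
                + 4 * \<epsilon> powr (- 1 / 2) * C\<^sub>\<Omega> *
                    (L2_norm \<Omega> (f 1) + (\<Sum>k = 2..n. L2_norm \<Omega> (\<lambda>x. f k x - f (k - 1) x))))"
proof -

  \<comment> \<open>Difference quotients, energy forms and square integrability\<close>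
  let ?E = "discrete_energy \<Omega> \<epsilon> \<kappa> t r u"
  let ?i = "L2_inner \<Omega>"
  define q where "q = diff_quot t u"
  define \<tau> where "\<tau> = time_step t"
  define G where "G = (\<lambda>i j. L2_inner \<Omega> (weak_grad \<Omega> (u i)) (weak_grad \<Omega> (u j)))"
  define K where "K = (\<lambda>i j. L2_inner \<Omega> (\<lambda>x. \<kappa> x * u i x) (u j))"
  have \<tau>: "0 < \<tau> k" if "k \<in> {1..N}" for k
    using mesh(4) that by (simp add: \<tau>_def time_step_def)
  have \<kappa>_meas: "\<kappa> \<in> borel_measurable (lebesgue_on \<Omega>)"
  proof (rule continuous_imp_measurable_on_sets_lebesgue)
    have "Ck_on 0 \<Omega> \<kappa>"
      using kappa(1) unfolding smooth_on_def by blast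
    then show "continuous_on \<Omega> \<kappa>"
      by simp
    show "\<Omega> \<in> sets lebesgue"
      using domain(1) by simp
  qed
  have uH: "u k \<in> H10 \<Omega>" if "k \<le> N" for k
    using that initial scheme by (cases k) (auto simp: bdf2_solution_def)
  note u = H10_L2(1)[OF uH] and du = H10_L2(2)[OF uH]
  have fL: "f k \<in> L2 \<Omega>" if "k \<in> {1..N}" for k
    using source that by auto
  have \<kappa>u: "(\<lambda>x. \<kappa> x * u k x) \<in> L2 \<Omega>" if "k \<le> N" for k
    using L2_bounded_scaleR[OF \<kappa>_meas kappa(2) u[OF that]] by simp
  have increment: "(\<lambda>x. u k x - u (k - 1) x) = (\<lambda>x. \<tau> k *\<^sub>R q k x)" if "k \<in> {1..N}" for k
    using \<tau>[OF that] by (auto simp: q_def \<tau>_def diff_quot_def)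
  have q: "q k \<in> L2 \<Omega>" if "k \<in> {1..N}" for k
    using L2_scaleR[OF L2_diff[OF u u], of k "k - 1" "1 / \<tau> k"] that
    by (auto simp: q_def diff_quot_def[abs_def] \<tau>_def)
  have inner_increment: "?i h (u k) - ?i h (u (k - 1)) = \<tau> k * ?i h (q k)"
    if "k \<in> {1..N}" "h \<in> L2 \<Omega>" for k h
    using L2_inner_diff_right[OF u u that(2), of k "k - 1"] that(1)
    unfolding increment[OF that(1)] L2_inner_scaleR_right by auto
  have E: "?E k = (if k = 0 then 0 else r (k + 1) / (1 + r (k + 1)) * \<tau> k * ?i (q k) (q k))
      + \<epsilon> * G k k - K k k" for k
    by (simp add: discrete_energy_def H1_seminorm_def L2_norm_power2 q_def \<tau>_def G_def K_def
        L2_inner_def)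

  \<comment> \<open>Convexity of the gradient and reaction energies\<close>
  have G_conv: "G i i - G j j \<le> 2 * (G i i - G i j)" if "i \<le> N" "j \<le> N" for i j
    using L2_inner_young[OF du[OF that(1)] du[OF that(2)], of 1] by (simp add: G_def)
  have K_conv: "2 * (K i i - K i j) \<le> K i i - K j j" if "i \<le> N" "j \<le> N" for i j
    using L2_weighted_convexity[OF \<kappa>_meas kappa(2,3) u[OF that(1)] u[OF that(2)]]
    by (simp add: K_def)

  \<comment> \<open>The BDF2 term dominates the kinetic increment\<close>
  have kinetic: "D2 t r u k \<in> L2 \<Omega> \<and>
      ?E k - \<epsilon> * G k k + K k k - (?E (k - 1) - \<epsilon> * G (k - 1) (k - 1) + K (k - 1) (k - 1))
      \<le> 2 * \<tau> k * ?i (D2 t r u k) (q k)" if k: "k \<in> {1..N}" for k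
  \<comment> \<open>Removing the gradient and reaction terms isolates the kinetic part of
    \<open>?E\<close>. Level 0 has none and the first step is BDF1, so for \<open>k = 1\<close> a
    crude bound on the weight suffices.\<close>
  proof (cases "k = 1")
    case True
    have D: "D2 t r u k = q k"
      using True by (auto simp: D2_def q_def diff_quot_def)
    have "0 < r (k + 1)"
      using ratio_bound k True by simp
    then have "r (k + 1) / (1 + r (k + 1)) \<le> 2"
      by (simp add: field_simps)
    then have "r (k + 1) / (1 + r (k + 1)) * (\<tau> k * ?i (q k) (q k)) \<le> 2 * (\<tau> k * ?i (q k) (q k))"
      using \<tau>[OF k] L2_inner_nonneg[of \<Omega> "q k"] by (intro mult_right_mono mult_nonneg_nonneg) auto
    then show ?thesis
      unfolding D using True k q[OF k] by (simp add: E mult.assoc)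
  next
    case False
    then have k': "k - 1 \<in> {1..N}" and k2: "k \<in> {2..N}"
      using k by auto
    have r: "0 < r k" "r k \<le> (3 + sqrt 17) / 2"
        "0 < r (k + 1)" "r (k + 1) \<le> (3 + sqrt 17) / 2"
      using ratio_bound k2 by auto
    have rk: "r k = \<tau> k / \<tau> (k - 1)"
      using ratios k2 by (simp add: \<tau>_def)
    let ?a = "(1 + 2 * r k) / (1 + r k)" and ?b = "r k / (1 + r k)"
    \<comment> \<open>In terms of difference quotients the coefficients depend on \<open>r k\<close>
      only, because \<open>(r k)\<^sup>2 * \<tau> (k - 1) / \<tau> k = r k\<close>.\<close>
    have D: "D2 t r u k = (\<lambda>x. ?a *\<^sub>R q k x - ?b *\<^sub>R q (k - 1) x)"
    proof
      fix x
      have 1: "u k x - u (k - 1) x = \<tau> k * q k x"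
        using increment[OF k] by (metis real_scaleR_def)
      have "k - 1 - 1 = k - 2" by simp
      then have 2: "u (k - 1) x - u (k - 2) x = \<tau> (k - 1) * q (k - 1) x"
        using increment[OF k'] by (metis real_scaleR_def)
      have "(r k)\<^sup>2 / (\<tau> k * (1 + r k)) * \<tau> (k - 1) = ?b"
        using \<tau>[OF k] \<tau>[OF k'] by (simp add: rk power2_eq_square)
      moreover have "(1 + 2 * r k) / (\<tau> k * (1 + r k)) * \<tau> k = ?a"
        using \<tau>[OF k] by simp
      ultimately show "D2 t r u k x = ?a *\<^sub>R q k x - ?b *\<^sub>R q (k - 1) x"
        using False unfolding D2_def \<tau>_def[symmetric] 1 2
        by (simp only: if_False real_scaleR_def mult.assoc[symmetric])
    qed
    have DL: "D2 t r u k \<in> L2 \<Omega>"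
      unfolding D by (intro L2_diff L2_scaleR q k k')
    have inner: "?i (D2 t r u k) (q k) = ?a * ?i (q k) (q k) - ?b * ?i (q k) (q (k - 1))"
      using q[OF k] q[OF k'] unfolding D
      by (simp add: L2_inner_diff_left[OF L2_scaleR L2_scaleR] L2_inner_scaleR_left
          L2_inner_commute[of \<Omega> "q (k - Suc 0)" "q k"] del: real_scaleR_def)
    have "\<tau> k * (r (k + 1) / (1 + r (k + 1)) * ?i (q k) (q k) - ?i (q (k - 1)) (q (k - 1)) / (1 + r k))
        \<le> \<tau> k * (2 * ?i (D2 t r u k) (q k))"
      unfolding inner using \<tau>[OF k] r L2_inner_young[OF q[OF k] q[OF k'], of "r k"]
      by (intro mult_left_mono bdf2_kinetic_bound L2_inner_nonneg) auto
    \<comment> \<open>This identity turns the term subtracted in the kinetic bound into exactly the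
      kinetic energy at level \<open>k - 1\<close>.\<close>
    moreover have "\<tau> k / (1 + r k) = ?b * \<tau> (k - 1)"
      using \<tau>[OF k'] by (simp add: rk)
    then have "\<tau> k * (?i (q (k - 1)) (q (k - 1)) / (1 + r k))
        = ?b * \<tau> (k - 1) * ?i (q (k - 1)) (q (k - 1))"
      by (metis times_divide_eq_left times_divide_eq_right)
    moreover have "?E k - \<epsilon> * G k k + K k k = \<tau> k * (r (k + 1) / (1 + r (k + 1)) * ?i (q k) (q k))"
      using k unfolding E[of k] by simp
    moreover have "?E (k - 1) - \<epsilon> * G (k - 1) (k - 1) + K (k - 1) (k - 1)
        = ?b * \<tau> (k - 1) * ?i (q (k - 1)) (q (k - 1))"
    proof -
      have "k - 1 \<noteq> 0" "k - 1 + 1 = k" using k2 by auto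
      then show ?thesis
        unfolding E[of "k - 1"] by (simp only: if_False)
    qed
    ultimately have "?E k - \<epsilon> * G k k + K k k
        - (?E (k - 1) - \<epsilon> * G (k - 1) (k - 1) + K (k - 1) (k - 1)) \<le> \<tau> k * (2 * ?i (D2 t r u k) (q k))"
      unfolding right_diff_distrib by linarith
    also have "\<dots> = 2 * \<tau> k * ?i (D2 t r u k) (q k)"
      by simp
    finally show ?thesis
      using DL by blast
  qed

  \<comment> \<open>The energy law for one step\<close>
  have law: "?E k - ?E (k - 1) \<le> 2 * (\<tau> k * ?i (f k) (q k))" if k: "k \<in> {1..N}" for k
  proof -
    have k1: "k - 1 \<le> N" "k \<le> N" using k by auto
    \<comment> \<open>Used for \<open>j = k\<close> and \<open>j = k - 1\<close>. For
      \<open>k = 1\<close> the latter tests with the initial value, admissible since it lies in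
      \<open>H10 \<Omega>\<close>.\<close>
    have weak: "?i (D2 t r u k) (u j) + \<epsilon> * G k j = K k j + ?i (f k) (u j)" if "j \<le> N" for j
      using scheme k uH[OF that] unfolding bdf2_solution_def G_def K_def by blast
    have "\<tau> k * ?i (D2 t r u k) (q k) + \<epsilon> * (G k k - G k (k - 1))
        = K k k - K k (k - 1) + \<tau> k * ?i (f k) (q k)"
      using weak[OF k1(1)] weak[OF k1(2)] inner_increment[OF k, of "D2 t r u k"]
        inner_increment[OF k fL[OF k]] kinetic[OF k] by (simp add: algebra_simps)
    moreover have "\<epsilon> * (G k k - G (k - 1) (k - 1)) \<le> \<epsilon> * (2 * (G k k - G k (k - 1)))"
      using eps_pos G_conv[OF k1(2,1)] by (intro mult_left_mono) auto
    ultimately show ?thesis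
      using kinetic[OF k] K_conv[OF k1(2,1)] by (simp add: algebra_simps)
  qed

  \<comment> \<open>Summation by parts in time\<close>
  let ?df = "\<lambda>k x. f k x - f (k - 1) x"
  let ?c = "\<epsilon> powr (- 1 / 2) * C\<^sub>\<Omega>"
  have summed: "?E n \<le> ?E 0 + 2 * (?i (f n) (u n) - ?i (f 1) (u 0)
      - (\<Sum>k = 2..n. ?i (?df k) (u (k - 1))))" if "1 \<le> n" "n \<le> N" for n
    using that
  proof (induction n rule: nat_induct_at_least)
    case base
    then show ?case
      using law[of 1] inner_increment[of 1 "f 1"] fL[of 1] by simp
  next
    case (Suc n)
    then have n: "Suc n \<in> {1..N}" "n \<in> {1..N}" by auto
    \<comment> \<open>Exchanging \<open>f (Suc n)\<close> for \<open>f n\<close> against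
      \<open>u n\<close> makes the boundary terms telescope; the error of the exchange is the new
      summand.\<close>
    have "?i (?df (Suc n)) (u n) = ?i (f (Suc n)) (u n) - ?i (f n) (u n)"
      using L2_inner_diff_left[OF fL fL u] n by simp
    then show ?case
      using law[OF n(1)] inner_increment[OF n(1) fL[OF n(1)]] Suc by simp
  qed

  \<comment> \<open>Coercivity of the energy and bounds for the source pairings\<close>
  have energy_lower: "\<epsilon> * G k k \<le> ?E k" if "k \<le> N" for k
  proof -
    \<comment> \<open>Convexity with the zero function, written as \<open>0\<close> times
      \<open>u k\<close>, in the first place.\<close>
    have "0 \<le> - K k k"
      using L2_weighted_convexity[OF \<kappa>_meas kappa(2,3) L2_scaleR[OF u[OF that], of 0] u[OF that]]
      by (simp add: K_def L2_inner_def)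
    moreover have "0 \<le> r (k + 1) / (1 + r (k + 1)) * \<tau> k * ?i (q k) (q k)" if "k \<noteq> 0"
    proof -
      \<comment> \<open>At \<open>k = N\<close> the ratio concerned is the extra number
        \<open>r (N + 1)\<close>.\<close>
      have k: "k \<in> {1..N}" "k + 1 \<in> {2..N + 1}"
        using that \<open>k \<le> N\<close> by auto
      then have "0 < r (k + 1)"
        using ratio_bound by blast
      then show ?thesis
        using \<tau>[OF k(1)] by (simp add: L2_inner_nonneg)
    qed
    ultimately show ?thesis
      unfolding E[of k] by (cases "k = 0") auto
  qed
  have E_nonneg: "0 \<le> ?E k" if "k \<le> N" for k
  proof -
    have "0 \<le> \<epsilon> * G k k"
      using eps_pos by (simp add: G_def L2_inner_nonneg)
    then show ?thesis
      using energy_lower[OF that] by linarith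
  qed
  \<comment> \<open>The gradient part of the energy controls the seminorm at the cost of
    \<open>\<epsilon> powr (- 1 / 2)\<close>; the Poincare inequality contributes
    \<open>C\<^sub>\<Omega>\<close>.\<close>
  have u_norm: "L2_norm \<Omega> (u k) \<le> ?c * sqrt (?E k)" if "k \<le> N" for k
  proof -
    have "sqrt \<epsilon> * H1_seminorm \<Omega> (u k) \<le> sqrt (?E k)"
      using real_sqrt_le_mono[OF energy_lower[OF that]]
      by (simp add: real_sqrt_mult G_def H1_seminorm_def L2_norm_def)
    then have "H1_seminorm \<Omega> (u k) \<le> 1 / sqrt \<epsilon> * sqrt (?E k)"
      using eps_pos by (simp add: field_simps)
    also have "1 / sqrt \<epsilon> = \<epsilon> powr (- 1 / 2)"
      using powr_minus[of \<epsilon> "1 / 2"] powr_half_sqrt[of \<epsilon>] eps_pos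
      by (simp only: minus_divide_left inverse_eq_divide less_imp_le)
    finally have "H1_seminorm \<Omega> (u k) \<le> \<epsilon> powr (- 1 / 2) * sqrt (?E k)" .
    then have "C\<^sub>\<Omega> * H1_seminorm \<Omega> (u k) \<le> C\<^sub>\<Omega> * (\<epsilon> powr (- 1 / 2) * sqrt (?E k))"
      using poincare(1) by (intro mult_left_mono) auto
    then show ?thesis
      using bspec[OF poincare(2) uH[OF that]] by (simp only: mult_ac)
  qed
  have duality: "\<bar>?i h (u k)\<bar> \<le> ?c * (sqrt (?E k) * L2_norm \<Omega> h)" if "k \<le> N" "h \<in> L2 \<Omega>" for k h
    using L2_Cauchy_Schwarz[OF that(2) u[OF that(1)]]
      mult_left_mono[OF u_norm[OF that(1)] L2_norm_nonneg[of \<Omega> h]] by (simp add: mult_ac)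

  have f_norm: "L2_norm \<Omega> (f n) \<le> L2_norm \<Omega> (f 1) + (\<Sum>k = 2..n. L2_norm \<Omega> (?df k))"
    if "1 \<le> n" "n \<le> N" for n
    using that
  proof (induction n rule: nat_induct_at_least)
    case (Suc n)
    then show ?case
      using L2_norm_le_add_diff[OF fL[of "Suc n"] fL[of n]] by simp
  qed simp

  \<comment> \<open>The quadratic estimate and its resolution by
    \<open>sqrt_energy_growth\<close>\<close>
  have bound: "(sqrt (?E n))\<^sup>2 \<le> (sqrt (?E 0))\<^sup>2 + 2 * ?c * (sqrt (?E n) * L2_norm \<Omega> (f n)
      + sqrt (?E 0) * L2_norm \<Omega> (f 1) + (\<Sum>k = 2..n. sqrt (?E (k - 1)) * L2_norm \<Omega> (?df k)))"
    if n: "n \<in> {1..N}" for n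
  proof -
    have summand: "- ?i (?df k) (u (k - 1)) \<le> ?c * (sqrt (?E (k - 1)) * L2_norm \<Omega> (?df k))"
      if "k \<in> {2..n}" for k
    proof -
      have k: "k \<in> {1..N}" "k - 1 \<in> {1..N}" "k - 1 \<le> N"
        using that n by auto
      show ?thesis
        using duality[OF k(3) L2_diff[OF fL[OF k(1)] fL[OF k(2)]]] by linarith
    qed
    have "- (\<Sum>k = 2..n. ?i (?df k) (u (k - 1)))
        \<le> ?c * (\<Sum>k = 2..n. sqrt (?E (k - 1)) * L2_norm \<Omega> (?df k))"
      unfolding sum_negf[symmetric] sum_distrib_left by (intro sum_mono summand)
    then have "?i (f n) (u n) - ?i (f 1) (u 0) - (\<Sum>k = 2..n. ?i (?df k) (u (k - 1)))
      \<le> ?c * (sqrt (?E n) * L2_norm \<Omega> (f n) + sqrt (?E 0) * L2_norm \<Omega> (f 1)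
        + (\<Sum>k = 2..n. sqrt (?E (k - 1)) * L2_norm \<Omega> (?df k)))"
      using duality[of n "f n"] duality[of 0 "f 1"] n fL[of n] fL[of 1]
      by (simp add: distrib_left)
    then show ?thesis
      using summed[of n] n E_nonneg[of n] E_nonneg[of 0] by (simp add: mult.assoc)
  qed

  show ?thesis
  proof (intro conjI ballI)
    fix k assume k: "k \<in> {1..N}"
    show "(?E k - ?E (k - 1)) / time_step t k \<le> 2 * ?i (f k) (diff_quot t u k)"
      using law[OF k] \<tau>[OF k] by (simp add: q_def \<tau>_def field_simps)
  next
    fix n assume n: "n \<in> {1..N}"
    have "sqrt (?E n) \<le> sqrt (?E 0)
        + 4 * ?c * (L2_norm \<Omega> (f 1) + (\<Sum>k = 2..n. L2_norm \<Omega> (?df k)))"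
    proof (rule sqrt_energy_growth[where N = N and e = "\<lambda>k. sqrt (?E k)"
          and \<phi> = "\<lambda>k. L2_norm \<Omega> (f k)" and \<delta> = "\<lambda>k. L2_norm \<Omega> (?df k)"])
      show "0 \<le> ?c"
        using poincare(1) by simp
    next
      fix k assume "k \<le> N"
      then show "0 \<le> sqrt (?E k)"
        using E_nonneg by simp
    next
      fix k assume "k \<in> {1..N}"
      then show "L2_norm \<Omega> (f k) \<le> L2_norm \<Omega> (f 1) + (\<Sum>j = 2..k. L2_norm \<Omega> (?df j))"
        using f_norm by simp
    qed (rule L2_norm_nonneg bound n; assumption?)+
    then show "sqrt (?E n) \<le> sqrt (?E 0) + 4 * \<epsilon> powr (- 1 / 2) * C\<^sub>\<Omega>
        * (L2_norm \<Omega> (f 1) + (\<Sum>k = 2..n. L2_norm \<Omega> (?df k)))"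
      by (simp only: mult.assoc)
  qed
qed

end
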